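(* The function $S(A)$ is conformally covariant of scaling dimension $-1$: If $\psi \in \mathrm{M\ddot{o}}(\mathbb{R}^d)$ then \[S(\psi(A)) = S(A) \prod_{a\in A} |\det D \psi(a)|^{1/d}\] for every finite set $A \subseteq \mathbb{R}^d \setminus \psi^{-1}(\infty)$ with at least two elements.
   Context: $d\ge1$ is an integer. $\mathrm{M\ddot{o}}(\mathbb{R}^d)$ denotes the group of transformations of $\mathbb{R}^d\cup\{\infty\}$ generated by Euclidean isometries, dilations, and the inversion in the unit sphere $x\mapsto x/\|x\|_2^2$. $D\psi(a)$ is the Jacobian matrix of $\psi$ at $a$. The function $S$, from finite subsets of $\mathbb{R}^d$ with at least two elements to $(0,\infty)$, is defined recursively by $S(\{x,y\})=\|x-y\|_2^2$ and, for $|A|\ge3$, $S(A)=\min\sqrt{S(A_1\cup A_2)S(A_2\cup A_3)S(A_3\cup A_1)}$, where the minimum is over partitions of $A$ into three non-empty subsets $A_1,A_2,A_3$. *)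

theory Defs
  imports "HOL-Analysis.Analysis" "HOL-Algebra.Bij" "HOL-Algebra.Generated_Groups"
begin

text \<open>The one-point compactification of \<open>\<real>\<^sup>d\<close> is represented by \<^typ>\<open>(real ^ 'n) option\<close> with \<open>None\<close>
  in the role of \<open>\<infinity>\<close>, as in \<^const>\<open>Alexandroff_compactification\<close>; \<open>d\<close> is \<open>CARD('n)\<close>.\<close>

definition isometry_maps :: "((real ^ 'n::finite) option \<Rightarrow> (real ^ 'n) option) set" where
  "isometry_maps = {map_option f | f. \<forall>x y. dist (f x) (f y) = dist x y}"

definition dilation_maps :: "((real ^ 'n::finite) option \<Rightarrow> (real ^ 'n) option) set" where
  "dilation_maps = {map_option (\<lambda>x. c *\<^sub>R x) | c. c > 0}"

definition sphere_inversion :: "(real ^ 'n::finite) option \<Rightarrow> (real ^ 'n) option" where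
  "sphere_inversion p = (case p of
      None \<Rightarrow> Some 0
    | Some x \<Rightarrow> if x = 0 then None else Some (x /\<^sub>R (norm x)\<^sup>2))"

definition Moebius :: "((real ^ 'n::finite) option \<Rightarrow> (real ^ 'n) option) set" where
  "Moebius = generate (BijGroup UNIV) (isometry_maps \<union> dilation_maps \<union> {sphere_inversion})"

text \<open>The restriction of \<open>\<psi>\<close> to \<open>\<real>\<^sup>d\<close>, meaningful only off \<open>\<psi>\<^sup>-\<^sup>1(\<infinity>)\<close>.\<close>

definition finite_part :: "((real ^ 'n::finite) option \<Rightarrow> (real ^ 'n) option) \<Rightarrow> real ^ 'n \<Rightarrow> real ^ 'n" where
  "finite_part \<psi> x = the (\<psi> (Some x))"

definition tripartitions :: "'a set \<Rightarrow> ('a set \<times> 'a set \<times> 'a set) set" where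
  "tripartitions A = {(A1, A2, A3). A1 \<union> A2 \<union> A3 = A
      \<and> A1 \<inter> A2 = {} \<and> A2 \<inter> A3 = {} \<and> A3 \<inter> A1 = {}
      \<and> A1 \<noteq> {} \<and> A2 \<noteq> {} \<and> A3 \<noteq> {}}"

lemma tripartitions_psubset:
  assumes "(A1, A2, A3) \<in> tripartitions A"
  shows "A1 \<union> A2 \<subset> A" "A2 \<union> A3 \<subset> A" "A3 \<union> A1 \<subset> A"
  using assms by (auto simp: tripartitions_def)

text \<open>The value outside finite sets with at least two elements is a dummy.\<close>

function S_fun :: "(real ^ 'n::finite) set \<Rightarrow> real" where
  "S_fun A =
    (if infinite A \<or> card A < 2 then 0
     else if card A = 2 then (THE r. \<exists>x y. x \<noteq> y \<and> A = {x, y} \<and> r = (norm (x - y))\<^sup>2)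
     else Min ((\<lambda>(A1, A2, A3). sqrt (S_fun (A1 \<union> A2) * S_fun (A2 \<union> A3) * S_fun (A3 \<union> A1)))
                 ` tripartitions A))"
  by pat_completeness auto
termination
  by (relation "Wellfounded.measure card") (auto intro!: psubset_card_mono dest: tripartitions_psubset)

declare S_fun.simps [simp del]

lemma S_fun_pair:
  assumes "x \<noteq> y"
  shows "S_fun {x, y} = (norm (x - y))\<^sup>2"
proof -
  have "(THE r. \<exists>u v. u \<noteq> v \<and> {x, y} = {u, v} \<and> r = (norm (u - v))\<^sup>2) = (norm (x - y))\<^sup>2"
    by (rule the_equality) (use assms in \<open>auto simp: doubleton_eq_iff norm_minus_commute\<close>)
  then show ?thesis
    using assms by (subst S_fun.simps) simp
qed

lemma S_fun_rec:
  assumes "finite A" "card A \<ge> 3"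
  shows "S_fun A = Min {sqrt (S_fun (A1 \<union> A2) * S_fun (A2 \<union> A3) * S_fun (A3 \<union> A1)) | A1 A2 A3.
           (A1, A2, A3) \<in> tripartitions A}"
proof -
  have "(\<lambda>(A1, A2, A3). sqrt (S_fun (A1 \<union> A2) * S_fun (A2 \<union> A3) * S_fun (A3 \<union> A1))) ` tripartitions A
      = {sqrt (S_fun (A1 \<union> A2) * S_fun (A2 \<union> A3) * S_fun (A3 \<union> A1)) | A1 A2 A3.
           (A1, A2, A3) \<in> tripartitions A}"
    by force
  then show ?thesis
    using assms by (subst S_fun.simps) simp
qed

end

(* Extend the squared distance to the one-point compactification by letting infinity be at squared
   distance 1 from every finite point. Each generator then satisfies
   q (psi x) (psi y) = l x * l y * q x y for some positive weight l, a property stable under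
   composition and inversion. At a point a with psi a finite, the derivative of such a map is l a times a
   linear isometry: clear if psi fixes infinity, as psi is then a similarity, and otherwise psi differs
   by an inversion from such a map. Hence |det D psi a| = l a ^ d. Finally S scales by the product of
   the weights, because each point of A occurs in exactly two of the three unions A1 Un A2, A2 Un A3,
   A3 Un A1, which compensates the square root. *)

theory Submission
  imports Defs
begin

section \<open>Inversion in the unit sphere, and determinants of linear similarities\<close>

lemma inverse_inner_self_eq: "x /\<^sub>R (norm x)\<^sup>2 = inverse (x \<bullet> x) *\<^sub>R x"
  by (simp add: power2_norm_eq_inner)

text \<open>Expanding the left side in inner products gives
  \<open>1/|x|^2 - 2 (x \<bullet> y) / (|x|^2 |y|^2) + 1/|y|^2\<close>; a common denominator turns
  the numerator into \<open>|x - y|^2\<close>.\<close>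

lemma norm_diff_inversion:
  fixes x y :: "'a::real_inner"
  assumes "x \<noteq> 0" "y \<noteq> 0"
  shows "(norm (x /\<^sub>R (norm x)\<^sup>2 - y /\<^sub>R (norm y)\<^sup>2))\<^sup>2
    = 1 / (norm x)\<^sup>2 * (1 / (norm y)\<^sup>2) * (norm (x - y))\<^sup>2"
proof -
  have "x \<bullet> x \<noteq> 0" "y \<bullet> y \<noteq> 0"
    using assms by auto
  then show ?thesis
    unfolding inverse_inner_self_eq
    by (simp add: power2_norm_eq_inner inner_diff_left inner_diff_right inner_commute field_simps)
qed

lemma norm_inversion:
  fixes x :: "'a::real_inner"
  shows "norm (x /\<^sub>R (norm x)\<^sup>2) = 1 / norm x"
  by (simp add: power2_eq_square field_simps)

lemma has_derivative_inversion:
  fixes y :: "'a::real_inner"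
  assumes "y \<noteq> 0"
  shows "((\<lambda>x. x /\<^sub>R (norm x)\<^sup>2) has_derivative
    (\<lambda>h. inverse (y \<bullet> y) *\<^sub>R h - (2 * (y \<bullet> h) * inverse (y \<bullet> y) ^ 2) *\<^sub>R y)) (at y)"
  unfolding inverse_inner_self_eq
  using assms
  by (auto intro!: derivative_eq_intros simp: inner_commute power2_eq_square algebra_simps)

text \<open>The derivative is \<open>1/|y|^2\<close> times the reflection in the hyperplane
  orthogonal to \<open>y\<close>, and a reflection preserves norms.\<close>

lemma norm_derivative_inversion:
  fixes y h :: "'a::real_inner"
  assumes "y \<noteq> 0"
  shows "norm (inverse (y \<bullet> y) *\<^sub>R h - (2 * (y \<bullet> h) * inverse (y \<bullet> y) ^ 2) *\<^sub>R y)
    = norm h / (norm y)\<^sup>2"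
proof -
  have "y \<bullet> y \<noteq> 0"
    using assms by auto
  then have "(norm (inverse (y \<bullet> y) *\<^sub>R h - (2 * (y \<bullet> h) * inverse (y \<bullet> y) ^ 2) *\<^sub>R y))\<^sup>2
      = (norm h / (norm y)\<^sup>2)\<^sup>2"
    unfolding power_divide power2_norm_eq_inner
    by (simp add: inner_diff_left inner_diff_right inner_commute
        power2_eq_square field_simps)
  then show ?thesis
    by (rule power2_eq_imp_eq) auto
qed

text \<open>Dividing \<open>D\<close> by \<open>c\<close> leaves an orthogonal map, of determinant 1
  or -1; the homothety contributes one factor \<open>c\<close> per dimension.\<close>

lemma abs_det_scaled_isometry:
  fixes D :: "real ^ 'n \<Rightarrow> real ^ 'n"
  assumes "linear D" and "c > 0" and D: "\<And>h. norm (D h) = c * norm h"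
  shows "\<bar>det (matrix D)\<bar> = c ^ CARD('n)"
proof -
  define T where "T = (\<lambda>h. D h /\<^sub>R c)"
  have T: "orthogonal_transformation T"
    unfolding orthogonal_transformation T_def
    using assms by (auto intro!: linear_compose_scale_right)
  have "D = (*\<^sub>R) c \<circ> T"
    using \<open>c > 0\<close> by (auto simp: T_def)
  moreover have "matrix ((*\<^sub>R) c \<circ> T) = matrix ((*\<^sub>R) c :: real ^ 'n \<Rightarrow> _) ** matrix T"
    using T by (intro matrix_compose) (auto simp: orthogonal_transformation_linear)
  ultimately have "det (matrix D) = c ^ CARD('n) * det (matrix T)"
    by (simp add: det_mul)
  then show ?thesis
    using T \<open>c > 0\<close> by (simp add: abs_mult)
qed

section \<open>Scaling of \<open>S_fun\<close> under pointwise weights\<close>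

text \<open>Parts of the image are pulled back by taking preimages inside \<open>A\<close>; in the
  other direction injectivity keeps the images of disjoint parts disjoint.\<close>

lemma tripartitions_image:
  assumes "inj_on f A"
  shows "tripartitions (f ` A) = (\<lambda>(A1, A2, A3). (f ` A1, f ` A2, f ` A3)) ` tripartitions A"
proof (intro equalityI subsetI)
  fix p assume "p \<in> tripartitions (f ` A)"
  then obtain B1 B2 B3 where p: "p = (B1, B2, B3)" and B: "(B1, B2, B3) \<in> tripartitions (f ` A)"
    by (cases p) auto
  define g where "g B = A \<inter> f -` B" for B
  have im: "f ` g B = B" if "B \<subseteq> f ` A" for B
    using that by (auto simp: g_def)
  have sub: "B1 \<subseteq> f ` A" "B2 \<subseteq> f ` A" "B3 \<subseteq> f ` A"
    using B by (auto simp: tripartitions_def)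
  have "g B1 \<union> g B2 \<union> g B3 = A"
    using B unfolding g_def tripartitions_def by blast
  moreover have "g B1 \<inter> g B2 = {}" "g B2 \<inter> g B3 = {}" "g B3 \<inter> g B1 = {}"
    using B unfolding g_def tripartitions_def by blast+
  moreover have "g B1 \<noteq> {}" "g B2 \<noteq> {}" "g B3 \<noteq> {}"
    using B im[OF sub(1)] im[OF sub(2)] im[OF sub(3)] unfolding tripartitions_def by auto
  ultimately have "(g B1, g B2, g B3) \<in> tripartitions A"
    by (simp add: tripartitions_def)
  then show "p \<in> (\<lambda>(A1, A2, A3). (f ` A1, f ` A2, f ` A3)) ` tripartitions A"
    by (intro image_eqI[of _ _ "(g B1, g B2, g B3)"]) (simp_all add: im sub p)
next
  fix p assume "p \<in> (\<lambda>(A1, A2, A3). (f ` A1, f ` A2, f ` A3)) ` tripartitions A"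
  then obtain A1 A2 A3 where p: "p = (f ` A1, f ` A2, f ` A3)"
    and t: "(A1, A2, A3) \<in> tripartitions A"
    by auto
  have sub: "A1 \<subseteq> A" "A2 \<subseteq> A" "A3 \<subseteq> A"
    using t by (auto simp: tripartitions_def)
  have disj: "f ` B \<inter> f ` C = {}" if "B \<subseteq> A" "C \<subseteq> A" "B \<inter> C = {}" for B C
    using inj_on_image_Int[OF assms that(1,2)] that(3) by simp
  have "f ` A1 \<inter> f ` A2 = {}" "f ` A2 \<inter> f ` A3 = {}" "f ` A3 \<inter> f ` A1 = {}"
    using t by (auto simp: tripartitions_def dest!: disj[OF sub(1,2)] disj[OF sub(2,3)] disj[OF sub(3,1)])
  then show "p \<in> tripartitions (f ` A)"
    using t by (simp add: p tripartitions_def flip: image_Un)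
qed

lemma tripartitions_nonempty:
  assumes "card A \<ge> 3"
  shows "tripartitions A \<noteq> {}"
proof -
  obtain B where "B \<subseteq> A" "card B = 3"
    using obtain_subset_with_card_n[OF assms] by metis
  then obtain x y z where "x \<in> A" "y \<in> A" "z \<in> A" "x \<noteq> y" "y \<noteq> z" "x \<noteq> z"
    by (auto simp: card_3_iff)
  then have "({x}, {y}, A - {x, y}) \<in> tripartitions A"
    by (auto simp: tripartitions_def)
  then show ?thesis
    by auto
qed

lemma finite_tripartitions:
  assumes "finite A"
  shows "finite (tripartitions A)"
  by (rule finite_subset[of _ "Pow A \<times> Pow A \<times> Pow A"])
    (use assms in \<open>auto simp: tripartitions_def\<close>)

text \<open>Strong induction on the cardinality: for a pair the claim is the assumed distance
  relation, and for larger sets the weights are drawn first out of the square root and then out of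
  the minimum.\<close>

lemma S_fun_image_weighted:
  fixes f :: "real ^ 'n \<Rightarrow> real ^ 'n" and w :: "real ^ 'n \<Rightarrow> real"
  assumes "finite A" "card A \<ge> 2" and "\<And>x. x \<in> A \<Longrightarrow> w x > 0"
    and "\<And>x y. x \<in> A \<Longrightarrow> y \<in> A \<Longrightarrow> (norm (f x - f y))\<^sup>2 = w x * w y * (norm (x - y))\<^sup>2"
  shows "S_fun (f ` A) = S_fun A * prod w A"
  using assms
proof (induction "card A" arbitrary: A rule: less_induct)
  case less
  have inj: "inj_on f A"
  proof (rule inj_onI)
    fix x y assume "x \<in> A" "y \<in> A" "f x = f y"
    then have "w x * w y * (norm (x - y))\<^sup>2 = 0" "w x > 0" "w y > 0"
      using less.prems(3) less.prems(4)[of x y] by auto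
    then show "x = y"
      by auto
  qed
  show ?case
  proof (cases "card A = 2")
    case True
    then obtain x y where A: "A = {x, y}" "x \<noteq> y"
      by (auto simp: card_2_iff)
    moreover have "f x \<noteq> f y"
      using inj A by auto
    ultimately show ?thesis
      using less.prems(4)[of x y] by (simp add: S_fun_pair)
  next
    case False
    then have A: "card A \<ge> 3"
      using less.prems by simp
    define F :: "(real ^ 'n) set \<times> (real ^ 'n) set \<times> (real ^ 'n) set \<Rightarrow> real"
      where "F = (\<lambda>(A1, A2, A3). sqrt (S_fun (A1 \<union> A2) * S_fun (A2 \<union> A3) * S_fun (A3 \<union> A1)))"
    have P: "prod w A > 0"
      using less.prems(3) by (intro prod_pos) auto
    have IH: "S_fun (f ` B) = S_fun B * prod w B" if "B \<subset> A" "card B \<ge> 2" for B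
      using that less.prems by (intro less.hyps) (auto intro: psubset_card_mono finite_subset)
    \<comment> \<open>The induction hypothesis speaks only of sets with at least two elements; a
      union of two disjoint non-empty parts is one.\<close>
    have card_Un: "card (B \<union> C) \<ge> 2" if "B \<union> C \<subset> A" "B \<inter> C = {}" "B \<noteq> {}" "C \<noteq> {}" for B C
    proof -
      have "finite B" "finite C"
        using that \<open>finite A\<close> by (auto intro: finite_subset)
      then show ?thesis
        using that card_0_eq[of B] card_0_eq[of C] by (subst card_Un_disjoint) linarith+
    qed
    have scale: "F (f ` A1, f ` A2, f ` A3) = F (A1, A2, A3) * prod w A"
      if t: "(A1, A2, A3) \<in> tripartitions A" for A1 A2 A3
    proof -
      have d: "A1 \<inter> A2 = {}" "A2 \<inter> A3 = {}" "A3 \<inter> A1 = {}" "A1 \<noteq> {}" "A2 \<noteq> {}" "A3 \<noteq> {}"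
        and U: "A = A1 \<union> A2 \<union> A3"
        using t by (auto simp: tripartitions_def)
      have fin: "finite A1" "finite A2" "finite A3"
        using U less.prems(1) by auto
      note ps = tripartitions_psubset[OF t]
      have eq: "S_fun (f ` A1 \<union> f ` A2) = S_fun (A1 \<union> A2) * (prod w A1 * prod w A2)"
        "S_fun (f ` A2 \<union> f ` A3) = S_fun (A2 \<union> A3) * (prod w A2 * prod w A3)"
        "S_fun (f ` A3 \<union> f ` A1) = S_fun (A3 \<union> A1) * (prod w A3 * prod w A1)"
        using IH[OF ps(1)] IH[OF ps(2)] IH[OF ps(3)] card_Un ps d fin
        by (simp_all add: image_Un prod.union_disjoint)
      have PA: "prod w A = prod w A1 * prod w A2 * prod w A3"
        using d fin unfolding U by (subst prod.union_disjoint) (auto simp: prod.union_disjoint)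
      have "S_fun (f ` A1 \<union> f ` A2) * S_fun (f ` A2 \<union> f ` A3) * S_fun (f ` A3 \<union> f ` A1)
          = S_fun (A1 \<union> A2) * S_fun (A2 \<union> A3) * S_fun (A3 \<union> A1) * (prod w A)\<^sup>2"
        unfolding eq PA by (simp add: power2_eq_square algebra_simps)
      then show ?thesis
        using P by (simp only: F_def prod.case) (simp add: real_sqrt_mult[of _ "(prod w A)\<^sup>2"])
    qed
    have S: "S_fun B = Min (F ` tripartitions B)" if "finite B" "card B \<ge> 3" for B
      unfolding F_def using that by (subst S_fun.simps) simp
    have "S_fun (f ` A) = Min (F ` tripartitions (f ` A))"
      using A less.prems(1) by (intro S) (auto simp: card_image[OF inj])
    also have "F ` tripartitions (f ` A) = (\<lambda>r. r * prod w A) ` F ` tripartitions A"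
      unfolding tripartitions_image[OF inj] image_image
      by (intro image_cong refl) (auto simp: scale)
    \<comment> \<open>Multiplication by the positive number \<open>prod w A\<close> is monotone, so
      it commutes with \<open>Min\<close>.\<close>
    also have "Min \<dots> = Min (F ` tripartitions A) * prod w A"
      using P A less.prems(1)
      by (intro mono_Min_commute[symmetric] finite_imageI finite_tripartitions)
        (auto simp: mono_def tripartitions_nonempty)
    finally show ?thesis
      using S[OF less.prems(1) A] by simp
  qed
qed

section \<open>Weighted conformality on the one-point compactification\<close>

text \<open>The value \<open>1\<close> between \<open>\<infinity>\<close> and a finite point is \<open>lim \<bar>x - y\<bar>\<^sup>2 / \<bar>y\<bar>\<^sup>2\<close> as \<open>y \<rightarrow> \<infinity>\<close>, i.e. the squared
  distance renormalised by a weight.\<close>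

fun qdist :: "'a::real_normed_vector option \<Rightarrow> 'a option \<Rightarrow> real" where
  "qdist (Some x) (Some y) = (norm (x - y))\<^sup>2"
| "qdist None None = 0"
| "qdist _ _ = 1"

text \<open>On finite points with finite images this is the classical Moebius identity
  \<open>|psi x - psi y|^2 = |psi'(x)| |psi'(y)| |x - y|^2\<close>, with \<open>w\<close> as the
  linear scale factor. Stating it without derivatives and with a weight at infinity makes it stable
  under composition even where a map meets infinity.\<close>

definition qconformal ::
    "('a::real_normed_vector option \<Rightarrow> 'a option) \<Rightarrow> ('a option \<Rightarrow> real) \<Rightarrow> bool" where
  "qconformal \<psi> w \<longleftrightarrow> (\<forall>x. w x > 0) \<and> (\<forall>x y. qdist (\<psi> x) (\<psi> y) = w x * w y * qdist x y)"

lemma qconformal_pos: "qconformal \<psi> w \<Longrightarrow> w x > 0"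
  and qconformal_eq: "qconformal \<psi> w \<Longrightarrow> qdist (\<psi> x) (\<psi> y) = w x * w y * qdist x y"
  by (auto simp: qconformal_def)

text \<open>Weights multiply as scale factors do under the chain rule.\<close>

lemma qconformal_comp:
  assumes "qconformal \<psi> v" "qconformal \<phi> w"
  shows "qconformal (\<psi> \<circ> \<phi>) (\<lambda>x. v (\<phi> x) * w x)"
  using assms by (simp add: qconformal_def algebra_simps)

lemma qconformal_inv:
  assumes "qconformal \<psi> w" "bij \<psi>"
  shows "qconformal (inv_into UNIV \<psi>) (\<lambda>x. 1 / w (inv_into UNIV \<psi> x))"
proof -
  have "qdist (inv_into UNIV \<psi> x) (inv_into UNIV \<psi> y) = 1 / w (inv_into UNIV \<psi> x) * (1 / w (inv_into UNIV \<psi> y)) * qdist x y" for x y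
    using qconformal_eq[OF assms(1), of "inv_into UNIV \<psi> x" "inv_into UNIV \<psi> y"] assms(2)
      qconformal_pos[OF assms(1), of "inv_into UNIV \<psi> x"] qconformal_pos[OF assms(1), of "inv_into UNIV \<psi> y"]
    by (simp add: surj_f_inv_f bij_is_surj field_simps)
  then show ?thesis
    using qconformal_pos[OF assms(1)] by (simp add: qconformal_def)
qed

text \<open>\<open>qdist\<close> vanishes only on the diagonal, and positive weights preserve its
  zeros.\<close>

lemma qconformal_inj:
  assumes "qconformal \<psi> w" "\<psi> x = \<psi> y"
  shows "x = y"
proof -
  have "qdist (\<psi> x) (\<psi> y) = 0"
    using assms(2) by (cases "\<psi> y") auto
  then have "qdist x y = 0"
    using qconformal_eq[OF assms(1), of x y] qconformal_pos[OF assms(1), of x]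
      qconformal_pos[OF assms(1), of y] by auto
  then show ?thesis
    by (cases x; cases y) auto
qed

lemma qconformal_isometry:
  assumes "\<And>x y. dist (f x) (f y) = dist x y"
  shows "qconformal (map_option f) (\<lambda>_. 1)"
proof -
  have "qdist (map_option f x) (map_option f y) = qdist x y" for x y
    using assms by (cases x; cases y) (auto simp: dist_norm)
  then show ?thesis
    by (simp add: qconformal_def)
qed

text \<open>The weight \<open>1 / c\<close> at infinity is forced: infinity stays at
  \<open>qdist\<close> 1 from every finite point, where the weight is \<open>c\<close>.\<close>

lemma qconformal_dilation:
  fixes c :: real
  assumes "c > 0"
  shows "qconformal (map_option (\<lambda>x. c *\<^sub>R x)) (case_option (1 / c) (\<lambda>_. c))"
proof -
  have "qdist (map_option (\<lambda>x. c *\<^sub>R x) x) (map_option (\<lambda>x. c *\<^sub>R x) y)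
      = case_option (1 / c) (\<lambda>_. c) x * case_option (1 / c) (\<lambda>_. c) y * qdist x y" for x y :: "'a option"
    using assms by (cases x; cases y)
      (auto simp flip: scaleR_diff_right simp: power_mult_distrib power2_eq_square)
  then show ?thesis
    using assms by (auto simp: qconformal_def split: option.splits)
qed

text \<open>Away from 0 and infinity this is the scale factor of the inversion. The value 1 at these
  two exchanged points is dictated by comparing each of them with a third point.\<close>

definition inversion_weight :: "'a::real_normed_vector option \<Rightarrow> real" where
  "inversion_weight p = (case p of None \<Rightarrow> 1 | Some x \<Rightarrow> if x = 0 then 1 else 1 / (norm x)\<^sup>2)"

lemma qconformal_inversion:
  "qconformal (sphere_inversion :: (real ^ 'n::finite) option \<Rightarrow> _) inversion_weight"
proof -
  have "qdist (sphere_inversion x) (sphere_inversion y)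
      = inversion_weight x * inversion_weight y * qdist x y" for x y :: "(real ^ 'n) option"
    by (cases x; cases y;
        auto simp: sphere_inversion_def inversion_weight_def norm_diff_inversion;
        simp add: power2_eq_square field_simps)
  then show ?thesis
    by (auto simp: qconformal_def inversion_weight_def split: option.splits)
qed

section \<open>From the generators to the whole Moebius group\<close>

lemma bij_map_option:
  assumes "bij f"
  shows "bij (map_option f)"
proof (rule o_bij)
  show "map_option (inv_into UNIV f) \<circ> map_option f = id" "map_option f \<circ> map_option (inv_into UNIV f) = id"
    using assms
    by (simp_all add: option.map_comp[symmetric] fun_eq_iff option.map_comp o_def option.map_ident
        bij_is_inj bij_is_surj surj_f_inv_f)
qed

text \<open>Subtracting \<open>f 0\<close> leaves an isometry fixing the origin, which is orthogonal
  and hence bijective; a translation restores \<open>f\<close>.\<close>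

lemma bij_isometry:
  fixes f :: "'a::euclidean_space \<Rightarrow> 'a"
  assumes "\<And>x y. dist (f x) (f y) = dist x y"
  shows "bij f"
proof -
  define T where "T = (\<lambda>x. f x - f 0)"
  have "orthogonal_transformation T"
    unfolding orthogonal_transformation_isometry T_def using assms by (auto simp: dist_norm)
  then have "bij ((\<lambda>x. x + f 0) \<circ> T)"
    by (rule bij_comp[OF orthogonal_transformation_bij bij_plus_right])
  then show ?thesis
    by (simp add: T_def o_def)
qed

lemma sphere_inversion_involution: "sphere_inversion (sphere_inversion p) = p"
  by (cases p) (auto simp: sphere_inversion_def power2_eq_square field_simps)

lemma Moebius_generator:
  assumes "\<psi> \<in> isometry_maps \<union> dilation_maps \<union> {sphere_inversion}"
  shows "bij \<psi> \<and> (\<exists>w. qconformal \<psi> w)"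
proof -
  consider f where "\<psi> = map_option f" "\<forall>x y. dist (f x) (f y) = dist x y"
    | c where "\<psi> = map_option (\<lambda>x. c *\<^sub>R x)" "c > 0" | "\<psi> = sphere_inversion"
    using assms by (auto simp: isometry_maps_def dilation_maps_def)
  then show ?thesis
  proof cases
    case 1
    then show ?thesis
      using bij_map_option[OF bij_isometry] qconformal_isometry by metis
  next
    case 2
    have "bij (\<lambda>x :: real ^ 'a. c *\<^sub>R x)"
      by (rule o_bij[of "\<lambda>x. x /\<^sub>R c"]) (use \<open>c > 0\<close> in auto)
    then show ?thesis
      using 2 bij_map_option qconformal_dilation by blast
  next
    case 3
    then show ?thesis
      using qconformal_inversion involuntory_imp_bij sphere_inversion_involution by blast
  qed
qed

lemma Moebius_qconformal:
  assumes "\<psi> \<in> Moebius"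
  shows "\<exists>w. qconformal \<psi> w"
proof -
  have Bij: "Bij UNIV = Collect bij"
    by (auto simp: Bij_def extensional_def)
  \<comment> \<open>Bijectivity is carried through the induction because the operations of
    \<open>BijGroup UNIV\<close> are ordinary inverse and composition only on its carrier.\<close>
  have "bij \<psi> \<and> (\<exists>w. qconformal \<psi> w)"
    using assms unfolding Moebius_def
  proof induction
    case one
    have "qconformal id (\<lambda>_. 1)"
      by (simp add: qconformal_def)
    then show ?case
      by (auto simp: BijGroup_def id_def[symmetric] simp del: id_apply)
  next
    case (incl h)
    then show ?case
      by (rule Moebius_generator)
  next
    case (inv h)
    then have "bij h \<and> (\<exists>w. qconformal h w)"
      by (rule Moebius_generator)
    moreover from this have "m_inv (BijGroup UNIV) h = inv_into UNIV h"
      by (subst inv_BijGroup) (auto simp: Bij)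
    ultimately show ?case
      using qconformal_inv bij_imp_bij_inv by fastforce
  next
    case (eng h1 h2)
    then have mult: "h1 \<otimes>\<^bsub>BijGroup UNIV\<^esub> h2 = h1 \<circ> h2"
      by (auto simp: BijGroup_def Bij compose_def)
    obtain v w where "bij h1" "bij h2" "qconformal h1 v" "qconformal h2 w"
      using eng by blast
    then show ?case
      unfolding mult by (intro conjI exI) (rule bij_comp qconformal_comp; assumption)+
  qed
  then show ?thesis ..
qed

section \<open>Derivatives at points with finite image\<close>

text \<open>Comparing a finite point with the fixed point infinity shows that the weight is constant
  on finite points. The map is then a similarity, that is, a translation after a multiple of an
  orthogonal map.\<close>

lemma qconformal_derivative_affine:
  fixes \<psi> :: "(real ^ 'n::finite) option \<Rightarrow> (real ^ 'n) option"
  assumes q: "qconformal \<psi> w" and inf: "\<psi> None = None"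
  shows "\<exists>D. (finite_part \<psi> has_derivative D) (at a) \<and> (\<forall>h. norm (D h) = w (Some a) * norm h)"
proof -
  define f where "f = finite_part \<psi>"
  define c where "c = w (Some a)"
  have c: "c > 0"
    using qconformal_pos[OF q] by (simp add: c_def)
  have f: "\<psi> (Some x) = Some (f x)" for x
    using qconformal_inj[OF q, of "Some x" None] inf
    by (cases "\<psi> (Some x)") (auto simp: f_def finite_part_def)
  have "w (Some x) * w None = 1" for x
    using qconformal_eq[OF q, of "Some x" None] by (simp add: f inf)
  then have w: "w (Some x) = c" for x
    unfolding c_def using qconformal_pos[OF q, of None] by (metis less_irrefl mult_right_cancel)
  have "(norm (f x - f y))\<^sup>2 = (c * norm (x - y))\<^sup>2" for x y
    using qconformal_eq[OF q, of "Some x" "Some y"]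
    by (simp add: f w power_mult_distrib power2_eq_square)
  then have norm_f: "norm (f x - f y) = c * norm (x - y)" for x y
    using c by (meson norm_ge_zero power2_eq_imp_eq mult_nonneg_nonneg less_imp_le)
  define T where "T = (\<lambda>x. (f x - f 0) /\<^sub>R c)"
  have T: "orthogonal_transformation T"
    unfolding orthogonal_transformation_isometry T_def dist_norm scaleR_diff_right[symmetric]
    using c by (auto simp: norm_f)
  have "f = (\<lambda>x. f 0 + c *\<^sub>R T x)"
    using c by (auto simp: T_def)
  moreover have "((\<lambda>x. f 0 + c *\<^sub>R T x) has_derivative (\<lambda>h. c *\<^sub>R T h)) (at a)"
    using T by (auto intro!: derivative_eq_intros linear_imp_has_derivative
        simp: orthogonal_transformation_linear)
  ultimately show ?thesis
    using T c unfolding f_def[symmetric] c_def[symmetric]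
    by (intro exI[of _ "\<lambda>h. c *\<^sub>R T h"]) (simp add: orthogonal_transformation_norm)
qed

text \<open>If infinity goes to a finite point \<open>b\<close>, moving \<open>b\<close> to 0 and
  inverting yields a map that fixes infinity, to which the affine case applies. Inverting back and
  using the chain rule gives the derivative of the original map.\<close>

lemma qconformal_derivative:
  fixes \<psi> :: "(real ^ 'n::finite) option \<Rightarrow> (real ^ 'n) option"
  assumes q: "qconformal \<psi> w" and fin: "\<psi> (Some a) \<noteq> None"
  shows "\<exists>D. (finite_part \<psi> has_derivative D) (at a) \<and> (\<forall>h. norm (D h) = w (Some a) * norm h)"
proof (cases "\<psi> None")
  case None
  then show ?thesis
    using qconformal_derivative_affine[OF q] by simp
next
  case (Some b)
  define \<tau> where "\<tau> = map_option (\<lambda>x. x - b)"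
  define \<phi> where "\<phi> = sphere_inversion \<circ> (\<tau> \<circ> \<psi>)"
  define g where "g = finite_part \<phi>"
  have "qconformal \<tau> (\<lambda>_. 1)"
    unfolding \<tau>_def by (rule qconformal_isometry) (simp add: dist_norm)
  then have q\<phi>: "qconformal \<phi> (\<lambda>x. inversion_weight ((\<tau> \<circ> \<psi>) x) * (1 * w x))"
    unfolding \<phi>_def using q by (intro qconformal_comp qconformal_inversion)
  have \<phi>_inf: "\<phi> None = None"
    by (simp add: \<phi>_def \<tau>_def sphere_inversion_def Some)
  have \<phi>: "\<phi> (Some x) = Some (g x)" for x
    using qconformal_inj[OF q\<phi>, of "Some x" None] \<phi>_inf
    by (cases "\<phi> (Some x)") (auto simp: g_def finite_part_def)
  define y where "y = finite_part \<psi> a"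
  have y: "\<psi> (Some a) = Some y"
    using fin by (auto simp: y_def finite_part_def)
  \<comment> \<open>The value \<open>b\<close> is already taken at infinity.\<close>
  have yb: "y \<noteq> b"
    using qconformal_inj[OF q, of "Some a" None] y Some by auto
  have weight: "inversion_weight ((\<tau> \<circ> \<psi>) (Some a)) = 1 / (norm (y - b))\<^sup>2"
    using yb by (simp add: inversion_weight_def \<tau>_def y)
  obtain D where D: "(g has_derivative D) (at a)"
    and norm_D: "\<And>h. norm (D h) = w (Some a) / (norm (y - b))\<^sup>2 * norm h"
    using qconformal_derivative_affine[OF q\<phi> \<phi>_inf, of a] unfolding g_def[symmetric] weight by auto
  \<comment> \<open>The inversion is its own inverse, so applying it to \<open>g x\<close> and
    adding \<open>b\<close> recovers the original map wherever \<open>g\<close> does not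
    vanish.\<close>
  have \<psi>: "finite_part \<psi> x = b + g x /\<^sub>R (norm (g x))\<^sup>2" if "g x \<noteq> 0" for x
  proof -
    have "(\<tau> \<circ> \<psi>) (Some x) = sphere_inversion (Some (g x))"
      by (simp add: \<phi>[symmetric]) (simp add: \<phi>_def sphere_inversion_involution)
    also have "\<dots> = Some (g x /\<^sub>R (norm (g x))\<^sup>2)"
      using that by (simp add: sphere_inversion_def)
    finally show ?thesis
      by (auto simp: \<tau>_def finite_part_def diff_eq_eq add.commute)
  qed
  have "Some (g a) = Some ((y - b) /\<^sub>R (norm (y - b))\<^sup>2)"
    unfolding \<phi>[symmetric] using yb by (simp add: \<phi>_def \<tau>_def y sphere_inversion_def)
  then have ga: "g a = (y - b) /\<^sub>R (norm (y - b))\<^sup>2"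
    by simp
  have ga0: "g a \<noteq> 0"
    using yb ga by simp
  \<comment> \<open>The scale factor of the second inversion at \<open>g a\<close>; it cancels the
    denominator in \<open>norm_D\<close>.\<close>
  have norm_ga: "1 / (norm (g a))\<^sup>2 = (norm (y - b))\<^sup>2"
    unfolding ga norm_inversion by (simp add: power_one_over)
  define I where "I = (\<lambda>h. inverse (g a \<bullet> g a) *\<^sub>R h
    - (2 * (g a \<bullet> h) * inverse (g a \<bullet> g a) ^ 2) *\<^sub>R g a)"
  have I: "((\<lambda>x. x /\<^sub>R (norm x)\<^sup>2) has_derivative I) (at (g a))"
    unfolding I_def using ga0 by (rule has_derivative_inversion)
  have "((\<lambda>x. b + x /\<^sub>R (norm x)\<^sup>2) has_derivative (\<lambda>h. 0 + I h)) (at (g a))"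
    by (rule has_derivative_add[OF has_derivative_const I])
  from diff_chain_at[OF D this]
  have ID: "((\<lambda>x. b + g x /\<^sub>R (norm (g x))\<^sup>2) has_derivative (\<lambda>h. I (D h))) (at a)"
    by (simp only: o_def add_0)
  have "isCont g a"
    using D by (rule has_derivative_continuous)
  \<comment> \<open>By continuity the formula for \<open>finite_part\<close> holds in a
    neighbourhood of \<open>a\<close>, which suffices to transfer the derivative.\<close>
  then have "\<forall>\<^sub>F x in at a. g x \<noteq> 0"
    using ga0 unfolding isCont_def by (rule tendsto_imp_eventually_ne)
  then have ev: "\<forall>\<^sub>F x in at a. b + g x /\<^sub>R (norm (g x))\<^sup>2 = finite_part \<psi> x"
    by eventually_elim (simp add: \<psi>)
  have "(finite_part \<psi> has_derivative (\<lambda>h. I (D h))) (at a)"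
    by (rule has_derivative_transform_eventually[OF ID ev]) (use ga0 in \<open>auto simp: \<psi>\<close>)
  moreover have "norm (I (D h)) = w (Some a) * norm h" for h
  proof -
    have "norm (I (D h)) = norm (D h) * (1 / (norm (g a))\<^sup>2)"
      unfolding I_def by (simp add: norm_derivative_inversion[OF ga0])
    then show ?thesis
      unfolding norm_ga norm_D using yb by simp
  qed
  ultimately show ?thesis
    by blast
qed

theorem mainTheorem19:
  fixes \<psi> :: "(real ^ 'n::finite) option \<Rightarrow> (real ^ 'n) option"
    and A :: "(real ^ 'n) set"
  assumes "\<psi> \<in> Moebius"
    and "finite A" and "card A \<ge> 2"
    and "\<forall>a\<in>A. \<psi> (Some a) \<noteq> None"
  shows "S_fun (finite_part \<psi> ` A) =
    S_fun A * (\<Prod>a\<in>A. \<bar>det (jacobian (finite_part \<psi>) (at a))\<bar> powr (1 / real CARD('n)))"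
proof -
  obtain w where q: "qconformal \<psi> w"
    using Moebius_qconformal[OF assms(1)] by blast
  have f: "\<psi> (Some a) = Some (finite_part \<psi> a)" if "a \<in> A" for a
    using assms(4) that by (auto simp: finite_part_def)
  have "S_fun (finite_part \<psi> ` A) = S_fun A * (\<Prod>a\<in>A. w (Some a))"
  proof (rule S_fun_image_weighted[OF assms(2,3)])
    fix x y assume "x \<in> A" "y \<in> A"
    then show "(norm (finite_part \<psi> x - finite_part \<psi> y))\<^sup>2
        = w (Some x) * w (Some y) * (norm (x - y))\<^sup>2"
      using qconformal_eq[OF q, of "Some x" "Some y"] by (simp add: f)
  qed (use qconformal_pos[OF q] in auto)
  \<comment> \<open>It remains to identify each weight with the Jacobian factor: the derivative at
    \<open>a\<close> scales norms by \<open>w (Some a)\<close>, so its determinant has absolute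
    value \<open>w (Some a) ^ CARD('n)\<close>.\<close>
  also have "(\<Prod>a\<in>A. w (Some a))
      = (\<Prod>a\<in>A. \<bar>det (jacobian (finite_part \<psi>) (at a))\<bar> powr (1 / real CARD('n)))"
  proof (rule prod.cong[OF refl])
    fix a assume "a \<in> A"
    then obtain D where D: "(finite_part \<psi> has_derivative D) (at a)"
      and norm_D: "\<And>h. norm (D h) = w (Some a) * norm h"
      using qconformal_derivative[OF q] assms(4) by blast
    have "\<bar>det (jacobian (finite_part \<psi>) (at a))\<bar> = w (Some a) ^ CARD('n)"
      unfolding jacobian_def frechet_derivative_at[OF D, symmetric]
      using D qconformal_pos[OF q] norm_D
      by (intro abs_det_scaled_isometry) (auto intro: has_derivative_linear)
    then show "w (Some a) = \<bar>det (jacobian (finite_part \<psi>) (at a))\<bar> powr (1 / real CARD('n))"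
      using qconformal_pos[OF q, of "Some a"] by (simp add: powr_powr flip: powr_realpow)
  qed
  finally show ?thesis .
qed

end
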